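(* Let $\varphi=\frac{\sqrt5-1}{2}$. For every $p\in[0,1]$ with $p\neq\varphi$ and every fixed integer $d\ge1$, $$\lim_{n\to\infty}F_n(d,p)=0,$$ where $F_n(d,p)=\Pr[G_n(p)\text{ is } d\text{-fragile}]$.
   Context: For an integer $n\ge 0$, consider the complete binary tree of depth $n$ (with $2^n$ leaves). A node has height $h$ if its distance to the leaves below it is $h$ (leaves have height $0$, the root has height $n$). A game of depth $n$ is an assignment of payoffs in $\{0,1\}$ to the leaves, i.e. an element of $\{0,1\}^{2^n}$. Player 2 acts at the internal nodes of odd height and Player 1 at the internal nodes of even height, each choosing a child; Player 1 wins if the payoff of the reached leaf is $1$, and Player 2 wins if it is $0$. The value of the game in $\{0,1\}$ is given by backward induction: the value of a leaf is its payoff, the value of an internal node of odd height is the minimum of the values of its two children, the value of an internal node of even height is the maximum of the values of its two children, and the value of the game is the value of the root. Player 1 wins the game if its value is $1$, and Player 2 wins if its value is $0$. For $i\in\{1,2\}$ let $W_n^i\subset\{0,1\}^{2^n}$ be the set of games of depth $n$ won by Player $i$, i.e. with value $2-i$. For an integer $d\ge1$, a game $G\in W_n^i$ is $d$-fragile if the Hamming distance of $G$ from the set $W_n^{3-i}$ is at most $d$. For $p\in[0,1]$, $G_n(p)\in\{0,1\}^{2^n}$ is the random game whose leaf payoffs are i.i.d. Bernoulli, equal to $1$ with probability $p$ and $0$ with probability $1-p$. *)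

theory Defs
  imports "HOL-Probability.Probability"
begin

definition games :: "nat \<Rightarrow> (nat \<Rightarrow> nat) set" where
  "games n = {..<2 ^ n} \<rightarrow>\<^sub>E {0, 1}"

(* The j-th node of height h (counted from the left, from 0) has as children the nodes
   2 * j and 2 * j + 1 of height h - 1; the nodes of height 0 are the leaves.
   In a tree of depth n, the root is node 0 of height n. *)
fun node_value :: "(nat \<Rightarrow> nat) \<Rightarrow> nat \<Rightarrow> nat \<Rightarrow> nat" where
  "node_value G 0 j = G j"
| "node_value G (Suc h) j =
     (if odd (Suc h)
      then min (node_value G h (2 * j)) (node_value G h (2 * j + 1))
      else max (node_value G h (2 * j)) (node_value G h (2 * j + 1)))"

definition game_value :: "nat \<Rightarrow> (nat \<Rightarrow> nat) \<Rightarrow> nat" where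
  "game_value n G = node_value G n 0"

(* Only used for i = 1 and i = 2, so that the subtraction does not truncate. *)
definition won_games :: "nat \<Rightarrow> nat \<Rightarrow> (nat \<Rightarrow> nat) set" where
  "won_games n i = {G \<in> games n. game_value n G = 2 - i}"

definition hamming_dist :: "nat \<Rightarrow> (nat \<Rightarrow> nat) \<Rightarrow> (nat \<Rightarrow> nat) \<Rightarrow> nat" where
  "hamming_dist n G H = card {k \<in> {..<2 ^ n}. G k \<noteq> H k}"

(* Extended naturals, so that the distance to the empty set would be infinite. *)
definition hamming_setdist :: "nat \<Rightarrow> (nat \<Rightarrow> nat) \<Rightarrow> (nat \<Rightarrow> nat) set \<Rightarrow> enat" where
  "hamming_setdist n G A = (INF H\<in>A. enat (hamming_dist n G H))"

definition fragile :: "nat \<Rightarrow> nat \<Rightarrow> (nat \<Rightarrow> nat) \<Rightarrow> bool" where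
  "fragile n d G \<longleftrightarrow>
     (\<exists>i\<in>{1, 2}. G \<in> won_games n i \<and> hamming_setdist n G (won_games n (3 - i)) \<le> enat d)"

(* The default value undefined outside {..<2 ^ n} matches the extensional functions in games n. *)
definition random_game :: "nat \<Rightarrow> real \<Rightarrow> (nat \<Rightarrow> nat) pmf" where
  "random_game n p = Pi_pmf {..<2 ^ n} undefined (\<lambda>_. map_pmf of_bool (bernoulli_pmf p))"

definition fragile_prob :: "nat \<Rightarrow> nat \<Rightarrow> real \<Rightarrow> real" where
  "fragile_prob n d p = measure_pmf.prob (random_game n p) {G. fragile n d G}"

end

theory Submission
  imports Defs
begin

text \<open>
  The least number of payoff changes that give a node the value \<open>v\<close> obeys a recursion: at the
  nodes of one player it is the sum over the two children, at those of the other it is their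
  minimum. In a fragile game this cost is at most \<open>d\<close> for both values, so it suffices to control
  one of them; we take \<open>v = 1\<close> for \<open>p < \<phi>\<close> and \<open>v = 0\<close> for \<open>p > \<phi>\<close>. Then the probability of
  cost \<open>0\<close> decays geometrically, \<open>\<phi>\<close> being the repelling fixed point of
  \<open>s \<mapsto> 1 - (1 - s\<^sup>2)\<^sup>2\<close>. If a sum of two costs is at most \<open>d + 1\<close>, then one of the
  summands is \<open>0\<close> or the other is at most \<open>d\<close>, and induction on \<open>d\<close> finishes the proof.
\<close>

section \<open>Flip costs and the distance to the other player's games\<close>

text \<open>\<open>h\<close> is the height of the parent. A minimum equals 1, and a maximum equals
  0, only if both children do, so there the costs add; otherwise one child suffices.\<close>

definition combine :: "nat \<Rightarrow> nat \<Rightarrow> nat \<Rightarrow> nat \<Rightarrow> nat" where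
  "combine v h x y = (if odd h \<longleftrightarrow> v = 1 then x + y else min x y)"

fun flip_cost :: "nat \<Rightarrow> (nat \<Rightarrow> nat) \<Rightarrow> nat \<Rightarrow> nat \<Rightarrow> nat" where
  "flip_cost v G 0 j = of_bool (G j \<noteq> v)"
| "flip_cost v G (Suc h) j =
     combine v (Suc h) (flip_cost v G h (2 * j)) (flip_cost v G h (2 * j + 1))"

definition leaves :: "nat \<Rightarrow> nat \<Rightarrow> nat set" where
  "leaves h j = {j * 2 ^ h..<(j + 1) * 2 ^ h}"

lemma leaves_0 [simp]: "leaves 0 j = {j}"
  by (auto simp: leaves_def)

lemma leaves_root: "leaves h 0 = {..<2 ^ h}"
  by (auto simp: leaves_def)

lemma finite_leaves [simp]: "finite (leaves h j)"
  by (simp add: leaves_def)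

lemma leaves_Suc: "leaves (Suc h) j = leaves h (2 * j) \<union> leaves h (2 * j + 1)"
  unfolding leaves_def by (subst ivl_disj_un_two(3)) (simp_all add: algebra_simps)

lemma leaves_disjoint: "leaves h (2 * j) \<inter> leaves h (2 * j + 1) = {}"
  by (auto simp: leaves_def)

lemma flip_cost_cong:
  "(\<And>k. k \<in> leaves h j \<Longrightarrow> G k = H k) \<Longrightarrow> flip_cost v G h j = flip_cost v H h j"
proof (induction h arbitrary: j)
  case (Suc h)
  have "flip_cost v G h (2 * j) = flip_cost v H h (2 * j)"
    and "flip_cost v G h (2 * j + 1) = flip_cost v H h (2 * j + 1)"
    by (rule Suc.IH, rule Suc.prems, simp add: leaves_Suc)+
  then show ?case by simp
qed simp

lemma node_value_le_1:
  "(\<And>k. k \<in> leaves h j \<Longrightarrow> H k \<le> 1) \<Longrightarrow> node_value H h j \<le> 1"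
proof (induction h arbitrary: j)
  case (Suc h)
  have "node_value H h (2 * j) \<le> 1" "node_value H h (2 * j + 1) \<le> 1"
    by (rule Suc.IH, rule Suc.prems, simp add: leaves_Suc)+
  then show ?case by (simp add: min.coboundedI1)
qed simp

text \<open>The disagreements of \<open>G\<close> and \<open>H\<close> split over the two subtrees.
  Where costs add, both children have the parent's value in \<open>H\<close>; elsewhere at least one
  has it, and its cost bounds the minimum. Payoffs at most 1 in \<open>H\<close> leave only the
  values 0 and 1.\<close>

lemma flip_cost_le_hamming:
  assumes "\<And>k. k \<in> leaves h j \<Longrightarrow> H k \<le> 1"
  shows "flip_cost (node_value H h j) G h j \<le> card {k \<in> leaves h j. G k \<noteq> H k}"
  using assms
proof (induction h arbitrary: j)
  case 0
  have "{k. k = j \<and> G k \<noteq> H k} = (if G j = H j then {} else {j})" by auto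
  then show ?case by auto
next
  case (Suc h)
  let ?l = "2 * j" and ?r = "2 * j + 1"
  let ?D = "\<lambda>j. {k \<in> leaves h j. G k \<noteq> H k}"
  have "{k \<in> leaves (Suc h) j. G k \<noteq> H k} = ?D ?l \<union> ?D ?r"
    by (auto simp: leaves_Suc)
  moreover have "card (?D ?l \<union> ?D ?r) = card (?D ?l) + card (?D ?r)"
    using leaves_disjoint[of h j] by (intro card_Un_disjoint) auto
  ultimately have card: "card {k \<in> leaves (Suc h) j. G k \<noteq> H k} = card (?D ?l) + card (?D ?r)"
    by simp
  have prems: "\<And>k. k \<in> leaves h ?l \<Longrightarrow> H k \<le> 1" "\<And>k. k \<in> leaves h ?r \<Longrightarrow> H k \<le> 1"
    by (rule Suc.prems, simp add: leaves_Suc)+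
  define a b where "a = node_value H h ?l" and "b = node_value H h ?r"
  have ab: "a \<le> 1" "b \<le> 1"
    unfolding a_def b_def by (intro node_value_le_1 prems; assumption)+
  have IH: "flip_cost a G h ?l \<le> card (?D ?l)" "flip_cost b G h ?r \<le> card (?D ?r)"
    unfolding a_def b_def by (intro Suc.IH prems; assumption)+
  have val: "node_value H (Suc h) j = (if odd (Suc h) then min a b else max a b)"
    unfolding a_def b_def by simp
  show ?case
    unfolding card val flip_cost.simps combine_def
    using IH ab by (cases "a = 0"; cases "b = 0") (auto simp: le_Suc_eq min_def max_def)
qed

lemma fragile_flip_cost_le:
  assumes "fragile n d G" and "v = 0 \<or> v = 1"
  shows "flip_cost v G n 0 \<le> d"
proof -
  obtain i where i: "i \<in> {1, 2}" and G: "G \<in> won_games n i"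
    and dist: "hamming_setdist n G (won_games n (3 - i)) \<le> enat d"
    using assms(1) unfolding fragile_def by blast
  have bound: "flip_cost (2 - k) G n 0 \<le> hamming_dist n G H" if "H \<in> won_games n k" for H k
  proof -
    have "H l \<le> 1" if "l \<in> leaves n 0" for l
    proof -
      have "H l \<in> {0, 1}"
        using \<open>H \<in> won_games n k\<close> that
        by (auto simp: won_games_def games_def leaves_root PiE_iff)
      then show ?thesis by auto
    qed
    moreover have "node_value H n 0 = 2 - k"
      using that by (simp add: won_games_def game_value_def)
    ultimately show ?thesis
      using flip_cost_le_hamming[of n 0 H G] by (simp add: leaves_root hamming_dist_def)
  qed
  \<comment> \<open>\<open>G\<close> itself is a game with value \<open>2 - i\<close>, at distance
    0.\<close>
  have same: "flip_cost (2 - i) G n 0 \<le> d"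
    using bound[OF G] by (simp add: hamming_dist_def)
  have other: "flip_cost (2 - (3 - i)) G n 0 \<le> d"
  proof -
    have "enat (flip_cost (2 - (3 - i)) G n 0) \<le> hamming_setdist n G (won_games n (3 - i))"
      unfolding hamming_setdist_def by (intro INF_greatest) (simp add: bound)
    then show ?thesis
      using dist order_trans enat_ord_simps(1) by blast
  qed
  \<comment> \<open>The values \<open>2 - i\<close> and \<open>2 - (3 - i)\<close> are 0 and 1 in
    some order, so \<open>v\<close> is one of them.\<close>
  show ?thesis
    using same other i assms(2) by auto
qed

section \<open>Law of the flip cost\<close>

text \<open>With i.i.d. leaves the law depends on the height alone, and the two children carry
  independent copies of it.\<close>

fun cost_pmf :: "nat \<Rightarrow> real \<Rightarrow> nat \<Rightarrow> nat pmf" where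
  "cost_pmf v p 0 = map_pmf (\<lambda>b. of_bool (of_bool b \<noteq> v)) (bernoulli_pmf p)"
| "cost_pmf v p (Suc h) =
     map_pmf (\<lambda>(x, y). combine v (Suc h) x y) (pair_pmf (cost_pmf v p h) (cost_pmf v p h))"

text \<open>The leaves of the two children are disjoint, so the product law factors, and each
  child's cost depends only on its own factor.\<close>

lemma map_flip_cost_Pi_pmf:
  "map_pmf (\<lambda>G. flip_cost v G h j)
     (Pi_pmf (leaves h j) undefined (\<lambda>_. map_pmf of_bool (bernoulli_pmf p))) = cost_pmf v p h"
proof (induction h arbitrary: j)
  case 0
  show ?case by (simp add: Pi_pmf_singleton pmf.map_comp o_def)
next
  case (Suc h)
  let ?l = "2 * j" and ?r = "2 * j + 1"
  let ?P = "\<lambda>A. Pi_pmf A undefined (\<lambda>_. map_pmf of_bool (bernoulli_pmf p)) :: (nat \<Rightarrow> nat) pmf"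
  have cost: "flip_cost v (\<lambda>x. if x \<in> leaves h ?l then f x else g x) (Suc h) j
      = combine v (Suc h) (flip_cost v f h ?l) (flip_cost v g h ?r)" for f g
  proof -
    let ?F = "\<lambda>x. if x \<in> leaves h ?l then f x else g x"
    have "flip_cost v ?F h ?l = flip_cost v f h ?l"
      by (rule flip_cost_cong) simp
    moreover have "flip_cost v ?F h ?r = flip_cost v g h ?r"
      using leaves_disjoint[of h j] by (intro flip_cost_cong) auto
    ultimately show ?thesis by simp
  qed
  have "map_pmf (\<lambda>G. flip_cost v G (Suc h) j) (?P (leaves (Suc h) j))
      = map_pmf (\<lambda>(f, g). combine v (Suc h) (flip_cost v f h ?l) (flip_cost v g h ?r))
          (pair_pmf (?P (leaves h ?l)) (?P (leaves h ?r)))"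
    unfolding leaves_Suc using leaves_disjoint[of h j]
    by (subst Pi_pmf_union)
      (simp_all add: pmf.map_comp o_def case_prod_unfold cost del: flip_cost.simps)
  also have "\<dots> = map_pmf (\<lambda>(x, y). combine v (Suc h) x y)
      (pair_pmf (map_pmf (\<lambda>f. flip_cost v f h ?l) (?P (leaves h ?l)))
                (map_pmf (\<lambda>g. flip_cost v g h ?r) (?P (leaves h ?r))))"
    by (simp add: map_pair pmf.map_comp o_def case_prod_unfold flip: map_pair)
  finally show ?case
    by (simp only: Suc.IH cost_pmf.simps)
qed

abbreviation cost_prob :: "nat \<Rightarrow> real \<Rightarrow> nat \<Rightarrow> nat \<Rightarrow> real" where
  "cost_prob v p h d \<equiv> measure_pmf.prob (cost_pmf v p h) {..d}"

lemma fragile_prob_le: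
  assumes "v = 0 \<or> v = 1"
  shows "fragile_prob n d p \<le> cost_prob v p n d"
proof -
  have "fragile_prob n d p
      \<le> measure_pmf.prob (random_game n p) ((\<lambda>G. flip_cost v G n 0) -` {..d})"
    unfolding fragile_prob_def
    by (intro measure_pmf.finite_measure_mono) (auto simp: fragile_flip_cost_le[OF _ assms])
  also have "\<dots> = cost_prob v p n d"
    by (simp add: random_game_def flip: leaves_root map_flip_cost_Pi_pmf[of v n 0])
  finally show ?thesis .
qed

section \<open>Recursive bounds and identities for the cost probabilities\<close>

lemma prob_pair_fst: "measure_pmf.prob (pair_pmf M N) (fst -` A) = measure_pmf.prob M A"
  by (metis map_fst_pair_pmf measure_map_pmf)

lemma prob_pair_snd: "measure_pmf.prob (pair_pmf M N) (snd -` A) = measure_pmf.prob N A"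
  by (metis map_snd_pair_pmf measure_map_pmf)

lemma prob_pair_le:
  assumes "S \<subseteq> fst -` A \<union> snd -` B"
  shows "measure_pmf.prob (pair_pmf M N) S \<le> measure_pmf.prob M A + measure_pmf.prob N B"
proof -
  have "measure_pmf.prob (pair_pmf M N) S
      \<le> measure_pmf.prob (pair_pmf M N) (fst -` A \<union> snd -` B)"
    using assms by (intro measure_pmf.finite_measure_mono) auto
  also have "\<dots> \<le> measure_pmf.prob M A + measure_pmf.prob N B"
    using measure_Un_le[of "fst -` A" "measure_pmf (pair_pmf M N)" "snd -` B"]
    by (simp add: prob_pair_fst prob_pair_snd)
  finally show ?thesis .
qed

lemma cost_prob_Suc:
  "cost_prob v p (Suc h) d = measure_pmf.prob (pair_pmf (cost_pmf v p h) (cost_pmf v p h))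
     {(x, y). combine v (Suc h) x y \<le> d}"
  by (simp add: vimage_def case_prod_unfold)

declare cost_pmf.simps [simp del]

text \<open>A sum or a minimum is at most \<open>d\<close> only if one of the two costs is, so the
  union bound covers nodes of either kind.\<close>

lemma cost_prob_Suc_le: "cost_prob v p (Suc h) d \<le> 2 * cost_prob v p h d"
proof -
  have "{(x, y). combine v (Suc h) x y \<le> d} \<subseteq> fst -` {..d} \<union> snd -` {..d}"
    by (auto simp: combine_def min_def split: if_splits)
  from prob_pair_le[OF this, of "cost_pmf v p h" "cost_pmf v p h"] show ?thesis
    unfolding cost_prob_Suc by simp
qed

lemma cost_prob_add_le:
  assumes "odd (Suc h) \<longleftrightarrow> v = 1"
  shows "cost_prob v p (Suc h) (Suc d) \<le> cost_prob v p h 0 + cost_prob v p h d"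
proof -
  have "{(x, y). combine v (Suc h) x y \<le> Suc d} \<subseteq> fst -` {..0} \<union> snd -` {..d}"
    using assms by (auto simp: combine_def)
  from prob_pair_le[OF this, of "cost_pmf v p h" "cost_pmf v p h"] show ?thesis
    unfolding cost_prob_Suc .
qed

text \<open>Of two consecutive heights exactly one adds costs and lowers \<open>Suc d\<close> to
  \<open>d\<close>; the other contributes the factor 2.\<close>

lemma cost_prob_step:
  "cost_prob v p (Suc (Suc h)) (Suc d) \<le> 2 * (cost_prob v p h 0 + cost_prob v p h d)"
proof (cases "odd (Suc h) \<longleftrightarrow> v = 1")
  case True
  have "cost_prob v p (Suc (Suc h)) (Suc d) \<le> 2 * cost_prob v p (Suc h) (Suc d)"
    by (rule cost_prob_Suc_le)
  also have "\<dots> \<le> 2 * (cost_prob v p h 0 + cost_prob v p h d)"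
    by (intro mult_left_mono cost_prob_add_le True) simp
  finally show ?thesis .
next
  case False
  then have "odd (Suc (Suc h)) \<longleftrightarrow> v = 1" by auto
  then have "cost_prob v p (Suc (Suc h)) (Suc d)
      \<le> cost_prob v p (Suc h) 0 + cost_prob v p (Suc h) d"
    by (rule cost_prob_add_le)
  also have "\<dots> \<le> 2 * cost_prob v p h 0 + 2 * cost_prob v p h d"
    by (intro add_mono cost_prob_Suc_le)
  finally show ?thesis by (simp add: distrib_left)
qed

text \<open>A sum is 0 iff both costs are, and independence turns this into a square.\<close>

lemma cost_prob_0_add:
  assumes "odd (Suc h) \<longleftrightarrow> v = 1"
  shows "cost_prob v p (Suc h) 0 = (cost_prob v p h 0)\<^sup>2"
proof -
  have *: "{(x, y). combine v (Suc h) x y \<le> 0} = {..0} \<times> {..0}"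
    using assms by (auto simp: combine_def)
  then show ?thesis
    unfolding cost_prob_Suc * by (subst measure_pmf_prob_product) (simp_all add: power2_eq_square)
qed

text \<open>Dually, a minimum is positive iff both costs are.\<close>

lemma cost_prob_0_min:
  assumes "\<not> (odd (Suc h) \<longleftrightarrow> v = 1)"
  shows "cost_prob v p (Suc h) 0 = 1 - (1 - cost_prob v p h 0)\<^sup>2"
proof -
  have *: "{(x, y). combine v (Suc h) x y \<le> 0} = UNIV - (- {..0}) \<times> (- {..0})"
    using assms by (auto simp: combine_def)
  have "measure_pmf.prob (pair_pmf (cost_pmf v p h) (cost_pmf v p h)) ((- {..0}) \<times> (- {..0}))
      = (1 - cost_prob v p h 0)\<^sup>2"
    using measure_pmf.prob_compl[of "{..0}" "cost_pmf v p h"]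
    by (subst measure_pmf_prob_product) (auto simp: power2_eq_square Compl_eq_Diff_UNIV)
  then show ?thesis
    unfolding cost_prob_Suc * using measure_pmf.prob_compl
    by (metis UNIV_I sets_measure_pmf space_measure_pmf)
qed

section \<open>Geometric decay of the probability of cost 0\<close>

text \<open>The geometric bound keeps the sequence below \<open>x 0\<close>, so \<open>step\<close>
  always applies. The factor \<open>c\<close> may thus depend on the starting point, as it must near
  a repelling fixed point.\<close>

lemma contraction_tendsto_0:
  fixes x :: "nat \<Rightarrow> real"
  assumes "\<And>k. 0 \<le> x k" and "c < 1"
    and step: "\<And>k. x k \<le> x 0 \<Longrightarrow> x (Suc k) \<le> c * x k"
  shows "x \<longlonglongrightarrow> 0"
proof -
  \<comment> \<open>\<open>c\<close> may be negative; the powers of \<open>e\<close> are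
    not.\<close>
  define e where "e = max c 0"
  have e: "0 \<le> e" "e < 1" using assms(2) by (auto simp: e_def)
  have bound: "x k \<le> e ^ k * x 0" for k
  proof (induction k)
    case (Suc k)
    have "e ^ k * x 0 \<le> x 0"
      using e assms(1)[of 0] by (simp add: mult_left_le_one_le power_le_one)
    then have "x (Suc k) \<le> c * x k" using Suc.IH step by simp
    also have "\<dots> \<le> e * x k" using assms(1) by (simp add: e_def mult_right_mono)
    also have "\<dots> \<le> e * (e ^ k * x 0)" using Suc.IH e by (simp add: mult_left_mono)
    finally show ?case by (simp add: mult_ac)
  qed simp
  have "(\<lambda>k. e ^ k * x 0) \<longlonglongrightarrow> 0"
    using e by (auto intro!: tendsto_mult_left_zero LIMSEQ_realpow_zero)
  then show ?thesis
    by (rule tendsto_sandwich[OF _ _ tendsto_const, rotated 2]) (auto simp: assms(1) bound)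
qed

lemma cost_prob_leaf:
  assumes "0 \<le> p" "p \<le> 1"
  shows "cost_prob 1 p 0 0 = p" and "cost_prob 0 p 0 0 = 1 - p"
proof -
  have "(\<lambda>b. of_bool (of_bool b \<noteq> (1::nat)) :: nat) -` {..0} = {True}"
    and "(\<lambda>b. of_bool (of_bool b \<noteq> (0::nat)) :: nat) -` {..0} = {False}"
    by (auto simp: of_bool_def split: if_splits)
  with assms show "cost_prob 1 p 0 0 = p" and "cost_prob 0 p 0 0 = 1 - p"
    unfolding cost_pmf.simps measure_map_pmf by (simp_all only:) (simp_all add: measure_pmf_single)
qed

lemma less_golden_iff:
  fixes p :: real
  assumes "0 \<le> p"
  shows "p < (sqrt 5 - 1) / 2 \<longleftrightarrow> p\<^sup>2 + p < 1"
proof -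
  have "p < (sqrt 5 - 1) / 2 \<longleftrightarrow> 2 * p + 1 < sqrt 5" by auto
  also have "\<dots> \<longleftrightarrow> (2 * p + 1)\<^sup>2 < 5"
    using assms real_less_rsqrt[of "2 * p + 1" 5] real_sqrt_less_iff[of "(2 * p + 1)\<^sup>2" 5] by auto
  also have "\<dots> \<longleftrightarrow> p\<^sup>2 + p < 1" by (auto simp: power2_eq_square algebra_simps)
  finally show ?thesis .
qed

lemma golden_less_iff:
  fixes p :: real
  assumes "0 \<le> p"
  shows "(sqrt 5 - 1) / 2 < p \<longleftrightarrow> 1 < p\<^sup>2 + p"
proof -
  have "(sqrt 5 - 1) / 2 < p \<longleftrightarrow> sqrt 5 < 2 * p + 1" by auto
  also have "\<dots> \<longleftrightarrow> 5 < (2 * p + 1)\<^sup>2"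
    using assms real_less_lsqrt[of 5 "2 * p + 1"] real_sqrt_less_iff[of 5 "(2 * p + 1)\<^sup>2"] by auto
  also have "\<dots> \<longleftrightarrow> 1 < p\<^sup>2 + p" by (auto simp: power2_eq_square algebra_simps)
  finally show ?thesis .
qed

text \<open>Two heights map s to 1 - (1 - s^2)^2 = s (2 s - s^3), and the ratio 2 s - s^3 increases
  on [0, p], so its value at p serves as contraction factor.\<close>

lemma value_1_prob_tendsto_0:
  assumes "0 \<le> p" "p < (sqrt 5 - 1) / 2"
  shows "(\<lambda>k. cost_prob 1 p (2 * k) 0) \<longlonglongrightarrow> 0"
proof (rule contraction_tendsto_0[where c = "2 * p - p ^ 3"])
  have p: "p\<^sup>2 + p < 1" using assms less_golden_iff by blast
  \<comment> \<open>A rational bound slightly above \<phi>, small enough for the monotonicity of 2 s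
    - s^3.\<close>
  have p23: "p < 2 / 3"
  proof (rule ccontr)
    assume "\<not> p < 2 / 3"
    then have "(2 / 3)\<^sup>2 \<le> p\<^sup>2" by (intro power_mono) auto
    then show False using p \<open>\<not> p < 2 / 3\<close> by (simp add: power2_eq_square)
  qed
  \<comment> \<open>The product equals 1 - (2 p - p^3).\<close>
  have "0 < (1 - p) * (1 - p - p\<^sup>2)" using p p23 by (intro mult_pos_pos) auto
  then show "2 * p - p ^ 3 < 1"
    by (simp add: algebra_simps power2_eq_square power3_eq_cube)
  fix k
  show "0 \<le> cost_prob 1 p (2 * k) 0" by simp
  define x where "x = cost_prob 1 p (2 * k) 0"
  assume "cost_prob 1 p (2 * k) 0 \<le> cost_prob 1 p (2 * 0) 0"
  then have x: "0 \<le> x" "x \<le> p"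
    using assms p23 cost_prob_leaf(1)[of p] by (simp_all add: x_def)
  have "p * p \<le> 2 / 3 * (2 / 3)" "p * x \<le> 2 / 3 * (2 / 3)" "x * x \<le> 2 / 3 * (2 / 3)"
    using x p23 assms by (intro mult_mono; linarith)+
  \<comment> \<open>The product equals (2 p - p^3) - (2 x - x^3).\<close>
  then have "0 \<le> (p - x) * (2 - p * p - p * x - x * x)"
    using x by (intro mult_nonneg_nonneg) linarith+
  then have "x * (2 * x - x ^ 3) \<le> x * (2 * p - p ^ 3)"
    using x by (intro mult_left_mono) (simp_all add: algebra_simps power3_eq_cube)
  moreover have eq: "cost_prob 1 p (2 * Suc k) 0 = 1 - (1 - x\<^sup>2)\<^sup>2"
    using cost_prob_0_add[of "2 * k" 1 p] cost_prob_0_min[of "Suc (2 * k)" 1 p]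
    by (simp add: x_def)
  ultimately show "cost_prob 1 p (2 * Suc k) 0 \<le> (2 * p - p ^ 3) * cost_prob 1 p (2 * k) 0"
    unfolding eq x_def[symmetric] by (simp add: algebra_simps power2_eq_square power3_eq_cube)
qed

text \<open>Now the minimum comes first: s goes to (1 - (1 - s)^2)^2 = s * (s (2 - s)^2), with fixed
  point 1 - \<phi>. The ratio s (2 - s)^2 increases on [0, q].\<close>

lemma value_0_prob_tendsto_0:
  assumes "p \<le> 1" "(sqrt 5 - 1) / 2 < p"
  shows "(\<lambda>k. cost_prob 0 p (2 * k) 0) \<longlonglongrightarrow> 0"
proof -
  define q where "q = 1 - p"
  have "0 < (sqrt 5 - 1) / 2" by simp
  then have "0 < p" using assms(2) by linarith
  then have "1 < p\<^sup>2 + p" using assms golden_less_iff[of p] by simp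
  then have q: "0 \<le> q" "q < 1" "0 < q\<^sup>2 - 3 * q + 1"
    using \<open>0 < p\<close> assms(1) by (simp_all add: q_def power2_eq_square algebra_simps)
  have q25: "q < 2 / 5"
  proof (rule ccontr)
    assume "\<not> q < 2 / 5"
    \<comment> \<open>On [2/5, 1] the square lies below its chord; with q^2 > 3 q - 1 this would
      give q < 3/8.\<close>
    then have "0 \<le> (q - 2 / 5) * (1 - q)" using q by (intro mult_nonneg_nonneg) auto
    also have "\<dots> = 7 / 5 * q - 2 / 5 - q\<^sup>2" by (simp add: power2_eq_square field_simps)
    finally show False using q \<open>\<not> q < 2 / 5\<close> by linarith
  qed
  show ?thesis
  proof (rule contraction_tendsto_0[where c = "q * (2 - q)\<^sup>2"])
    \<comment> \<open>The product equals 1 - q (2 - q)^2.\<close>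
    have "0 < (1 - q) * (q\<^sup>2 - 3 * q + 1)" using q by (intro mult_pos_pos) auto
    then show "q * (2 - q)\<^sup>2 < 1"
      by (simp add: algebra_simps power2_eq_square)
    fix k
    show "0 \<le> cost_prob 0 p (2 * k) 0" by simp
    define x where "x = cost_prob 0 p (2 * k) 0"
    assume "cost_prob 0 p (2 * k) 0 \<le> cost_prob 0 p (2 * 0) 0"
    then have x: "0 \<le> x" "x \<le> q"
      using assms \<open>0 < p\<close> cost_prob_leaf(2)[of p]
      by (simp_all add: x_def q_def)
    have "q * x \<le> 1 * 1" "1 * 1 \<le> (2 - q - x) * (2 - q - x)"
      using x q25 q by (intro mult_mono; linarith)+
    \<comment> \<open>The product equals q (2 - q)^2 - x (2 - x)^2.\<close>
    then have "0 \<le> (q - x) * ((2 - q - x) * (2 - q - x) - q * x)"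
      using x by (intro mult_nonneg_nonneg) linarith+
    then have "x * (x * (2 - x)\<^sup>2) \<le> x * (q * (2 - q)\<^sup>2)"
      using x by (intro mult_left_mono) (simp_all add: algebra_simps power2_eq_square)
    moreover have eq: "cost_prob 0 p (2 * Suc k) 0 = (1 - (1 - x)\<^sup>2)\<^sup>2"
      using cost_prob_0_min[of "2 * k" 0 p] cost_prob_0_add[of "Suc (2 * k)" 0 p]
      by (simp add: x_def)
    ultimately show "cost_prob 0 p (2 * Suc k) 0 \<le> q * (2 - q)\<^sup>2 * cost_prob 0 p (2 * k) 0"
      unfolding eq x_def[symmetric] by (simp add: algebra_simps power2_eq_square)
  qed
qed

section \<open>From cost 0 at even heights to every cost and height\<close>

text \<open>An odd height at most doubles the probability at the even height just below it.\<close>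

lemma cost_prob_0_tendsto_0:
  assumes even: "(\<lambda>k. cost_prob v p (2 * k) 0) \<longlonglongrightarrow> 0"
  shows "(\<lambda>h. cost_prob v p h 0) \<longlonglongrightarrow> 0"
proof -
  have "(\<lambda>k. cost_prob v p (2 * k + 1) 0) \<longlonglongrightarrow> 0"
  proof (rule tendsto_sandwich[OF _ _ tendsto_const])
    show "(\<lambda>k. 2 * cost_prob v p (2 * k) 0) \<longlonglongrightarrow> 0"
      using even by (rule tendsto_mult_right_zero)
    show "\<forall>\<^sub>F k in sequentially. cost_prob v p (2 * k + 1) 0 \<le> 2 * cost_prob v p (2 * k) 0"
      using cost_prob_Suc_le[of v p _ 0] by simp
  qed simp
  with even show ?thesis by (rule limseq_even_odd)
qed

lemma cost_prob_tendsto_0: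
  assumes zero: "(\<lambda>h. cost_prob v p h 0) \<longlonglongrightarrow> 0"
  shows "(\<lambda>h. cost_prob v p h d) \<longlonglongrightarrow> 0"
proof (induction d)
  case (Suc d)
  have "(\<lambda>h. cost_prob v p (h + 2) (Suc d)) \<longlonglongrightarrow> 0"
  proof (rule tendsto_sandwich[OF _ _ tendsto_const])
    show "(\<lambda>h. 2 * (cost_prob v p h 0 + cost_prob v p h d)) \<longlonglongrightarrow> 0"
      using zero Suc.IH by (intro tendsto_mult_right_zero tendsto_add_zero)
    show "\<forall>\<^sub>F h in sequentially.
        cost_prob v p (h + 2) (Suc d) \<le> 2 * (cost_prob v p h 0 + cost_prob v p h d)"
      using cost_prob_step[of v p _ d] by simp
  qed simp
  then show ?case by (rule LIMSEQ_offset)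
qed (rule zero)

theorem proposition8:
  fixes p :: real and d :: nat
  assumes "0 \<le> p" and "p \<le> 1" and "p \<noteq> (sqrt 5 - 1) / 2" and "d \<ge> 1"
  shows "(\<lambda>n. fragile_prob n d p) \<longlonglongrightarrow> 0"
proof -
  \<comment> \<open>Fragility bounds the costs of both values, so \<open>v\<close> may be chosen by
    the side of \<phi> on which \<open>p\<close> lies.\<close>
  have "\<exists>v. (v = 0 \<or> v = 1) \<and> (\<lambda>k. cost_prob v p (2 * k) 0) \<longlonglongrightarrow> 0"
  proof (cases "p < (sqrt 5 - 1) / 2")
    case True
    then show ?thesis using value_1_prob_tendsto_0[OF assms(1)] by blast
  next
    case False
    then have "(sqrt 5 - 1) / 2 < p" using assms(3) by linarith
    then show ?thesis using value_0_prob_tendsto_0[OF assms(2)] by blast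
  qed
  then obtain v where v: "v = 0 \<or> v = 1"
    and even: "(\<lambda>k. cost_prob v p (2 * k) 0) \<longlonglongrightarrow> 0" by blast
  show ?thesis
  proof (rule tendsto_sandwich[OF _ _ tendsto_const cost_prob_tendsto_0[OF cost_prob_0_tendsto_0[OF even]]])
    show "\<forall>\<^sub>F n in sequentially. 0 \<le> fragile_prob n d p"
      by (simp add: fragile_prob_def)
    show "\<forall>\<^sub>F n in sequentially. fragile_prob n d p \<le> cost_prob v p n d"
      using fragile_prob_le[OF v] by simp
  qed
qed

end
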